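(* Let $p \in \mathbb{N}$. Then the sequence $(|M_{p,n}|)_{n=1}^\infty$ satisfies: (1) for every $n \in \mathbb{N}$, $$|M_{p,n+p}| \ =\ 1 + \sum_{k=1}^{n+p-1}\ \sum_{0 \le j \le k/p-2}\binom{n+p-k-1}{j},$$ where $j$ ranges over integers; and (2) for every integer $n \ge 1$, $$|M_{p,n+p+1}| \ =\ |M_{p,n+p}| + |M_{p,n}|.$$
   Context: $\mathbb{N} = \{1,2,3,\dots\}$. For $p, n \in \mathbb{N}$, define $$M_{p,n} := \{S \subseteq \mathbb{N} : S \text{ is finite and nonempty},\ \max S = n,\ \min S \ge p|S|\},$$ where $|S|$ denotes the cardinality of $S$. Empty sums are $0$ (in particular the inner sum is $0$ when $k/p < 2$), and $\binom{a}{j} = 0$ for integers $0 \le a < j$. *)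

theory Defs
  imports Complex_Main
begin

(* The sets S consist of positive integers, hence S \<subseteq> {1..}. *)
definition M :: "nat \<Rightarrow> nat \<Rightarrow> nat set set" where
  "M p n = {S. S \<subseteq> {1..} \<and> finite S \<and> S \<noteq> {} \<and> Max S = n \<and> Min S \<ge> p * card S}"

(* card and sum return 0 on infinite sets; the next two facts rule this out for the
   cardinalities and the index sets of the inner sums used in the theorem. *)
lemma finite_M: "finite (M p n)"
proof (rule finite_subset)
  show "M p n \<subseteq> Pow {..n}"
    by (auto simp: M_def)
qed simp

lemma finite_inner_index: "finite {j::nat. real j \<le> real k / real p - 2}"
proof (rule finite_subset)
  show "{j::nat. real j \<le> real k / real p - 2} \<subseteq> {..nat \<lfloor>real k / real p\<rfloor>}"
    by (auto simp: le_nat_floor)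
qed simp

end

theory Submission
  imports Defs
begin

text \<open>
  The sum formula sorts the members \<open>S\<close> of \<open>M p N\<close> by their minimum and cardinality. The
  singleton \<open>{N}\<close> is a member as soon as \<open>N \<ge> p\<close>, and gives the summand \<open>1\<close>. Any other member
  has a minimum \<open>k < N\<close> and \<open>j + 2\<close> elements, of which \<open>j\<close> lie strictly between \<open>k\<close> and \<open>N\<close>.
  These \<open>j\<close> elements are arbitrary, so they are chosen in \<open>(N - k - 1) choose j\<close> ways, subject only
  to \<open>p * (j + 2) \<le> k\<close>, which is the range \<open>j \<le> k / p - 2\<close> of the inner sum
  (\<open>card_M_eq_sum_over_minima\<close>).

  The recurrence does not go through this formula. The members \<open>S\<close> of \<open>M p (n + p + 1)\<close> are split
  according to whether they contain \<open>n + p\<close>. If not, the maximum can be lowered by one, which gives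
  exactly the members of \<open>M p (n + p)\<close> (\<open>card_M_Suc_avoiding\<close>). If so, deleting the maximum leaves a
  set with maximum \<open>n + p\<close> and one element fewer; the bound on the minimum then has slack \<open>p\<close>,
  which is used up by translating the set down by \<open>p\<close>. This gives exactly the members of \<open>M p n\<close>
  (\<open>card_M_Suc_containing\<close>).
\<close>

text \<open>
  Since \<open>S\<close> is nonempty, \<open>p * card S \<ge> 1\<close>, so the lower bound on the elements also makes them
  positive.
\<close>

lemma mem_M_iff:
  assumes "p \<ge> 1"
  shows "S \<in> M p n \<longleftrightarrow> finite S \<and> n \<in> S \<and> (\<forall>x\<in>S. x \<le> n \<and> p * card S \<le> x)"
proof
  assume S: "S \<in> M p n"
  then have *: "finite S" "S \<noteq> {}" "Max S = n" "p * card S \<le> Min S"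
    by (auto simp: M_def)
  have "n \<in> S"
    using Max_in *(1-3) by blast
  moreover have "x \<le> n \<and> p * card S \<le> x" if "x \<in> S" for x
    using that * Max_ge Min_le le_trans by metis
  ultimately show "finite S \<and> n \<in> S \<and> (\<forall>x\<in>S. x \<le> n \<and> p * card S \<le> x)"
    using *(1) by blast
next
  assume *: "finite S \<and> n \<in> S \<and> (\<forall>x\<in>S. x \<le> n \<and> p * card S \<le> x)"
  then have "card S \<ge> 1"
    by (metis One_nat_def Suc_leI card_gt_0_iff empty_iff)
  then have "p * card S \<ge> 1"
    using assms by simp
  then have "S \<subseteq> {1..}"
    using * le_trans by fastforce
  moreover have "Max S = n"
    using * by (intro Max_eqI) auto
  moreover have "S \<noteq> {}"
    using * by blast
  moreover from this have "p * card S \<le> Min S"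
    using * Min_in by blast
  ultimately show "S \<in> M p n"
    using * by (simp add: M_def)
qed

lemma le_divide_minus_two_iff:
  assumes "p \<ge> 1"
  shows "real j \<le> real k / real p - 2 \<longleftrightarrow> p * (j + 2) \<le> k"
proof -
  have "real j \<le> real k / real p - 2 \<longleftrightarrow> real j + 2 \<le> real k / real p"
    by linarith
  also have "\<dots> \<longleftrightarrow> (real j + 2) * real p \<le> real k"
    using assms by (simp add: pos_le_divide_eq)
  also have "\<dots> \<longleftrightarrow> real (p * (j + 2)) \<le> real k"
    by (simp add: algebra_simps)
  finally show ?thesis
    by (simp only: of_nat_le_iff)
qed

theorem card_M_eq_sum_over_minima:
  assumes "p \<ge> 1" "N \<ge> p"
  shows "card (M p N) = 1 + (\<Sum>k = 1..N - 1. \<Sum>j\<in>{j::nat. real j \<le> real k / real p - 2}.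
                               (N - k - 1) choose j)"
proof -
  define J where "J k = {j::nat. real j \<le> real k / real p - 2}" for k :: nat
  have J_iff: "j \<in> J k \<longleftrightarrow> p * (j + 2) \<le> k" for j k
    using le_divide_minus_two_iff[OF assms(1)] by (simp add: J_def)
  have finite_J: "finite (J k)" for k
    unfolding J_def by (rule finite_inner_index)
  define B where "B k j = {A. A \<subseteq> {k<..<N} \<and> card A = j}" for k j
  have finite_B: "finite (B k j)" for k j
    by (rule finite_subset[of _ "Pow {k<..<N}"]) (auto simp: B_def)
  have card_B: "card (B k j) = (N - k - 1) choose j" for k j
    unfolding B_def by (subst n_subsets) auto
  \<comment> \<open>A triple consists of the minimum \<open>k\<close>, the number \<open>j\<close> of interior elements, and their set.\<close>
  define X where "X = (SIGMA k:{1..N - 1}. SIGMA j:J k. B k j)"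
  define f where "f = (\<lambda>(k, j::nat, A). insert k (insert N A))"
  define g where "g S = (Min S, card S - 2, S - {Min S, N})" for S

  have f: "f (k, j, A) \<in> M p N - {{N}} \<and> g (f (k, j, A)) = (k, j, A)"
    if "(k, j, A) \<in> X" for k j A
  proof -
    from that have k: "1 \<le> k" "k < N" and j: "p * (j + 2) \<le> k"
      and A: "A \<subseteq> {k<..<N}" "card A = j"
      by (auto simp: X_def B_def J_iff)
    have "finite A" "k \<notin> A" "N \<notin> A"
      using A(1) finite_subset by auto
    then have card: "card (insert k (insert N A)) = j + 2"
      using k A(2) by simp
    have "Min (insert k (insert N A)) = k"
      using \<open>finite A\<close> k A(1) by (intro Min_eqI) auto
    moreover have "insert k (insert N A) \<in> M p N"
      unfolding mem_M_iff[OF assms(1)] card using \<open>finite A\<close> k j A(1) by fastforce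
    ultimately show ?thesis
      using card k \<open>k \<notin> A\<close> \<open>N \<notin> A\<close> by (auto simp: f_def g_def)
  qed
  have g: "g S \<in> X \<and> f (g S) = S" if "S \<in> M p N - {{N}}" for S
  proof -
    from that have S: "finite S" "N \<in> S" "\<And>x. x \<in> S \<Longrightarrow> x \<le> N \<and> p * card S \<le> x" "S \<noteq> {N}"
      by (auto simp: mem_M_iff[OF assms(1)])
    define k where "k = Min S"
    have k: "k \<in> S" "\<And>x. x \<in> S \<Longrightarrow> k \<le> x"
      using Min_in[OF S(1)] Min_le[OF S(1)] S(2) unfolding k_def by blast+
    have "k \<noteq> N"
      using S(2,3,4) k(2) by (metis antisym insertI1 singletonD subsetI subset_singletonD empty_iff)
    then have "k < N"
      using S(3) k(1) le_neq_implies_less by blast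
    have card: "card S = card (S - {k, N}) + 2"
    proof -
      have "S = insert k (insert N (S - {k, N}))"
        using k(1) S(2) by blast
      then have "card S = card (insert k (insert N (S - {k, N})))"
        by simp
      then show ?thesis
        using S(1) \<open>k \<noteq> N\<close> by simp
    qed
    have bound: "p * (card (S - {k, N}) + 2) \<le> k"
      using S(3)[OF k(1)] card by simp
    then have "k \<ge> 1"
      using assms(1) by (cases k) auto
    moreover have "S - {k, N} \<subseteq> {k<..<N}"
      using S(3) k(2) by (auto simp: order.strict_iff_order)
    ultimately have "(k, card S - 2, S - {k, N}) \<in> X"
      using bound card \<open>k < N\<close> by (auto simp: X_def B_def J_iff)
    then show ?thesis
      using k(1) S(2) by (auto simp: f_def g_def k_def)
  qed
  have "bij_betw f X (M p N - {{N}})"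
  proof (rule bij_betw_byWitness[where f' = g])
    show "\<forall>t\<in>X. g (f t) = t" "f ` X \<subseteq> M p N - {{N}}"
      using f by auto
    show "\<forall>S\<in>M p N - {{N}}. f (g S) = S" "g ` (M p N - {{N}}) \<subseteq> X"
      using g by blast+
  qed
  then have "card (M p N - {{N}}) = card X"
    by (simp add: bij_betw_same_card)
  also have "\<dots> = (\<Sum>k = 1..N - 1. \<Sum>j\<in>J k. (N - k - 1) choose j)"
    unfolding X_def by (simp add: finite_J finite_B card_B)
  finally have "card (M p N - {{N}}) = (\<Sum>k = 1..N - 1. \<Sum>j\<in>J k. (N - k - 1) choose j)" .
  moreover have "{N} \<in> M p N"
    using assms by (simp add: mem_M_iff)
  then have "card (M p N) = 1 + card (M p N - {{N}})"
    using card.remove[OF finite_M] by simp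
  ultimately show ?thesis
    by (simp add: J_def)
qed

text \<open>
  Exchanging the maximum \<open>m + 1\<close> for \<open>m\<close> keeps the cardinality. It also keeps the minimum, except on
  a singleton, where the lowered minimum \<open>m\<close> still satisfies the bound because \<open>m \<ge> p\<close>.
\<close>

lemma card_M_Suc_avoiding:
  assumes "p \<ge> 1" "m \<ge> p"
  shows "card {S \<in> M p (Suc m). m \<notin> S} = card (M p m)"
proof -
  define f where "f S = insert m (S - {Suc m})" for S
  define g where "g T = insert (Suc m) (T - {m})" for T
  have f: "f S \<in> M p m \<and> g (f S) = S" if "S \<in> {S \<in> M p (Suc m). m \<notin> S}" for S
  proof -
    from that have S: "finite S" "Suc m \<in> S" "m \<notin> S"
      "\<And>x. x \<in> S \<Longrightarrow> x \<le> Suc m \<and> p * card S \<le> x"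
      by (auto simp: mem_M_iff[OF assms(1)])
    have card: "card (f S) = card S"
      using S(1,3) card_Suc_Diff1[OF S(1,2)] by (simp add: f_def)
    have upper: "x \<le> m" if "x \<in> f S" for x
      using that S(4) by (force simp: f_def le_Suc_eq)
    have "p * card S \<le> m"
    proof (cases "S = {Suc m}")
      case True
      then show ?thesis using assms(2) by simp
    next
      case False
      then obtain x where "x \<in> S" "x \<noteq> Suc m"
        using S(2) by blast
      then show ?thesis
        using S(4)[of x] by simp
    qed
    then have "f S \<in> M p m"
      unfolding mem_M_iff[OF assms(1)] card using S upper by (auto simp: f_def)
    then show ?thesis
      using S(2,3) by (auto simp: f_def g_def)
  qed
  have g: "g T \<in> {S \<in> M p (Suc m). m \<notin> S} \<and> f (g T) = T" if "T \<in> M p m" for T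
  proof -
    from that have T: "finite T" "m \<in> T" "\<And>x. x \<in> T \<Longrightarrow> x \<le> m \<and> p * card T \<le> x"
      by (auto simp: mem_M_iff[OF assms(1)])
    have "Suc m \<notin> T"
      using T(3) by fastforce
    then have card: "card (g T) = card T"
      using T(1) card_Suc_Diff1[OF T(1,2)] by (simp add: g_def)
    have "g T \<in> M p (Suc m)"
      unfolding mem_M_iff[OF assms(1)] card using T by (auto simp: g_def le_Suc_eq)
    then show ?thesis
      using T(2) \<open>Suc m \<notin> T\<close> by (auto simp: f_def g_def)
  qed
  have "bij_betw f {S \<in> M p (Suc m). m \<notin> S} (M p m)"
    using f g by (intro bij_betw_byWitness[where f' = g]) auto
  then show ?thesis
    by (rule bij_betw_same_card)
qed

text \<open>
  Translating by \<open>p\<close> raises the minimum by exactly the amount that one additional element costs in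
  the bound \<open>p * card S\<close>; the additional element is the new maximum.
\<close>

lemma card_M_Suc_containing:
  assumes "p \<ge> 1"
  shows "card {S \<in> M p (Suc (n + p)). n + p \<in> S} = card (M p n)"
proof -
  define f where "f T = insert (Suc (n + p)) ((\<lambda>x. x + p) ` T)" for T
  define g where "g S = (\<lambda>x. x - p) ` (S - {Suc (n + p)})" for S
  have f: "f T \<in> {S \<in> M p (Suc (n + p)). n + p \<in> S} \<and> g (f T) = T" if "T \<in> M p n" for T
  proof -
    from that have T: "finite T" "n \<in> T" "\<And>x. x \<in> T \<Longrightarrow> x \<le> n \<and> p * card T \<le> x"
      by (auto simp: mem_M_iff[OF assms])
    have new: "Suc (n + p) \<notin> (\<lambda>x. x + p) ` T"
      using T(3) by fastforce
    then have card: "card (f T) = Suc (card T)"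
      using T(1) by (simp add: f_def card_image)
    have "f T \<in> M p (Suc (n + p))"
      unfolding mem_M_iff[OF assms] card using T by (fastforce simp: f_def)
    moreover have "g (f T) = T"
      using new by (simp add: f_def g_def image_image)
    ultimately show ?thesis
      using T(2) by (auto simp: f_def)
  qed
  have g: "g S \<in> M p n \<and> f (g S) = S" if "S \<in> {S \<in> M p (Suc (n + p)). n + p \<in> S}" for S
  proof -
    from that have S: "finite S" "Suc (n + p) \<in> S" "n + p \<in> S"
      "\<And>x. x \<in> S \<Longrightarrow> x \<le> Suc (n + p) \<and> p * card S \<le> x"
      by (auto simp: mem_M_iff[OF assms])
    define R where "R = S - {Suc (n + p)}"
    have card_S: "card S = Suc (card R)"
      unfolding R_def by (rule card.remove[OF S(1,2)])
    \<comment> \<open>In particular no element of \<open>R\<close> is below \<open>p\<close>, so the subtraction in \<open>g\<close> is not truncated.\<close>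
    have R: "x \<le> n + p \<and> p + p * card R \<le> x" if "x \<in> R" for x
      using that S(4)[of x] card_S by (auto simp: R_def le_Suc_eq)
    have "inj_on (\<lambda>x. x - p) R"
      by (rule inj_on_diff_nat) (use R in fastforce)
    then have card: "card (g S) = card R"
      by (simp add: g_def R_def card_image)
    have "n \<in> g S"
      using S(3) by (force simp: g_def)
    moreover have "y \<le> n \<and> p * card R \<le> y" if "y \<in> g S" for y
      using that R by (fastforce simp: g_def simp flip: R_def)
    ultimately have "g S \<in> M p n"
      unfolding mem_M_iff[OF assms] card using S(1) by (auto simp: g_def)
    moreover have "(\<lambda>x. x + p) ` g S = R"
    proof -
      have "x - p + p = x" if "x \<in> R" for x
        using R[OF that] by simp
      then show ?thesis
        by (simp add: g_def image_image flip: R_def)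
    qed
    then have "f (g S) = S"
      using S(2) by (auto simp: f_def R_def)
    ultimately show ?thesis ..
  qed
  have "bij_betw f (M p n) {S \<in> M p (Suc (n + p)). n + p \<in> S}"
    using f g by (intro bij_betw_byWitness[where f' = g]) auto
  then show ?thesis
    by (simp add: bij_betw_same_card)
qed

theorem card_M_recurrence:
  assumes "p \<ge> 1"
  shows "card (M p (n + p + 1)) = card (M p (n + p)) + card (M p n)"
proof -
  let ?C = "{S \<in> M p (Suc (n + p)). n + p \<in> S}" and ?A = "{S \<in> M p (Suc (n + p)). n + p \<notin> S}"
  have "card (M p (Suc (n + p))) = card (?A \<union> ?C)"
    by (rule arg_cong[where f = card]) blast
  also have "\<dots> = card ?A + card ?C"
    using finite_M[of p "Suc (n + p)"] by (intro card_Un_disjoint) auto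
  finally show ?thesis
    using card_M_Suc_avoiding[OF assms, of "n + p"] card_M_Suc_containing[OF assms, of n] by simp
qed

theorem theorem1p1:
  fixes p :: nat
  assumes "p \<ge> 1"
  shows "(\<forall>n\<ge>1. card (M p (n + p)) =
            1 + (\<Sum>k = 1..n + p - 1. \<Sum>j\<in>{j::nat. real j \<le> real k / real p - 2}.
                   (n + p - k - 1) choose j)) \<and>
         (\<forall>n\<ge>1. card (M p (n + p + 1)) = card (M p (n + p)) + card (M p n))"
  using card_M_eq_sum_over_minima[OF assms] card_M_recurrence[OF assms] by simp

end
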